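(* Let $\mathcal{K}$ be an essentially small tensor triangulated category whose spectrum $\operatorname{Spc}(\mathcal{K})$ is weakly Noetherian. Then the following are equivalent: (a) every radical ideal in $\mathcal{K}$ is finitely generated; (b) $\operatorname{Spc}(\mathcal{K})$ is finite.
   Context: A tensor triangulated category (tt-category) is a triangulated category $\mathcal{K}$ with a symmetric monoidal structure $(\otimes,\mathbb{1})$ whose tensor product is exact in each variable. An ideal in $\mathcal{K}$ means a thick tensor ideal: a full triangulated subcategory closed under direct summands and under tensoring with arbitrary objects of $\mathcal{K}$. For a collection of objects $X_1,\dots,X_n$, $\langle X_1,\dots,X_n\rangle_\otimes$ denotes the smallest ideal containing them. The radical of an ideal $\mathcal{I}$ is $\sqrt{\mathcal{I}}=\{x\in\mathcal{K} : x^{\otimes n}\in\mathcal{I}\text{ for some } n\geq 1\}$, and $\mathcal{I}$ is radical if $\sqrt{\mathcal{I}}=\mathcal{I}$. A radical ideal $\mathcal{I}$ is finitely generated if there are finitely many objects $X_1,\dots,X_n\in\mathcal{K}$ with $\mathcal{I}=\sqrt{\langle X_1,\dots,X_n\rangle_\otimes}$. A prime ideal is a proper ideal $\mathcal{P}$ such that $x\otimes y\in\mathcal{P}$ implies $x\in\mathcal{P}$ or $y\in\mathcal{P}$. The (Balmer) spectrum $\operatorname{Spc}(\mathcal{K})$ is the set of prime ideals of $\mathcal{K}$ with the topology having the sets $\operatorname{supp}(x)=\{\mathcal{P} : x\notin\mathcal{P}\}$, $x\in\mathcal{K}$, as a basis of closed subsets; it is a spectral space. Let $X$ be a spectral space.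 A subset of $X$ is Thomason if it is a union of complements of quasi-compact open subsets of $X$. A subset $V\subseteq X$ is weakly visible if there are Thomason subsets $W_1,W_2\subseteq X$ with $V=W_1\cap(X\setminus W_2)$; a point $x$ is weakly visible if $\{x\}$ is. $X$ is weakly Noetherian if every point of $X$ is weakly visible. *)

theory Defs
  imports "HOL-Analysis.Abstract_Topology"
begin

section \<open>Categories\<close>

text \<open>
  A category is given by a set of objects and a set of arrows. Every arrow determines its source
  and its target, so the sets \<open>Hom K x y\<close> below are pairwise disjoint. Since objects and arrows
  are elements of types, all categories here are small; no separate size condition is stated.
\<close>

record ('o, 'm) category =
  obj :: "'o set"
  arr :: "'m set"
  src :: "'m \<Rightarrow> 'o"
  tgt :: "'m \<Rightarrow> 'o"
  idt :: "'o \<Rightarrow> 'm" ("\<one>\<index>")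
  comp :: "'m \<Rightarrow> 'm \<Rightarrow> 'm" (infixr "\<cdot>\<index>" 75)

definition Hom :: "('o, 'm, 'x) category_scheme \<Rightarrow> 'o \<Rightarrow> 'o \<Rightarrow> 'm set" where
  "Hom K x y = {f \<in> arr K. src K f = x \<and> tgt K f = y}"

locale category =
  fixes K :: "('o, 'm, 'x) category_scheme" (structure)
  assumes src_closed: "f \<in> arr K \<Longrightarrow> src K f \<in> obj K"
    and tgt_closed: "f \<in> arr K \<Longrightarrow> tgt K f \<in> obj K"
    and idt_closed: "x \<in> obj K \<Longrightarrow> \<one> x \<in> Hom K x x"
    and comp_closed: "\<lbrakk>f \<in> Hom K x y; g \<in> Hom K y z\<rbrakk> \<Longrightarrow> g \<cdot> f \<in> Hom K x z"
    and comp_idt_right: "f \<in> Hom K x y \<Longrightarrow> f \<cdot> \<one> x = f"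
    and comp_idt_left: "f \<in> Hom K x y \<Longrightarrow> \<one> y \<cdot> f = f"
    and comp_assoc: "\<lbrakk>f \<in> Hom K w x; g \<in> Hom K x y; h \<in> Hom K y z\<rbrakk>
      \<Longrightarrow> (h \<cdot> g) \<cdot> f = h \<cdot> (g \<cdot> f)"

definition iso_arr :: "('o, 'm, 'x) category_scheme \<Rightarrow> 'o \<Rightarrow> 'o \<Rightarrow> 'm \<Rightarrow> bool" where
  "iso_arr K x y f \<longleftrightarrow> f \<in> Hom K x y \<and>
     (\<exists>g \<in> Hom K y x. g \<cdot>\<^bsub>K\<^esub> f = \<one>\<^bsub>K\<^esub> x \<and> f \<cdot>\<^bsub>K\<^esub> g = \<one>\<^bsub>K\<^esub> y)"

definition isomorphic :: "('o, 'm, 'x) category_scheme \<Rightarrow> 'o \<Rightarrow> 'o \<Rightarrow> bool" where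
  "isomorphic K x y \<longleftrightarrow> (\<exists>f. iso_arr K x y f)"


section \<open>Additive categories\<close>

record ('o, 'm) preadditive = "('o, 'm) category" +
  plus_arr :: "'m \<Rightarrow> 'm \<Rightarrow> 'm" (infixl "\<oplus>\<index>" 65)
  zero_arr :: "'o \<Rightarrow> 'o \<Rightarrow> 'm" ("\<zero>\<index>")
  neg_arr :: "'m \<Rightarrow> 'm" ("\<ominus>\<index> _" [81] 80)

definition zero_object :: "('o, 'm, 'x) preadditive_scheme \<Rightarrow> 'o \<Rightarrow> bool" where
  "zero_object K z \<longleftrightarrow> z \<in> obj K \<and>
     (\<forall>x \<in> obj K. Hom K x z = {\<zero>\<^bsub>K\<^esub> x z} \<and> Hom K z x = {\<zero>\<^bsub>K\<^esub> z x})"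

definition is_biproduct :: "('o, 'm, 'x) preadditive_scheme \<Rightarrow> 'o \<Rightarrow> 'o \<Rightarrow> 'o \<Rightarrow> bool" where
  "is_biproduct K x y b \<longleftrightarrow> x \<in> obj K \<and> y \<in> obj K \<and> b \<in> obj K \<and>
     (\<exists>i \<in> Hom K x b. \<exists>j \<in> Hom K y b. \<exists>p \<in> Hom K b x. \<exists>q \<in> Hom K b y.
        p \<cdot>\<^bsub>K\<^esub> i = \<one>\<^bsub>K\<^esub> x \<and> q \<cdot>\<^bsub>K\<^esub> j = \<one>\<^bsub>K\<^esub> y \<and>
        p \<cdot>\<^bsub>K\<^esub> j = \<zero>\<^bsub>K\<^esub> y x \<and> q \<cdot>\<^bsub>K\<^esub> i = \<zero>\<^bsub>K\<^esub> x y \<and>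
        (i \<cdot>\<^bsub>K\<^esub> p) \<oplus>\<^bsub>K\<^esub> (j \<cdot>\<^bsub>K\<^esub> q) = \<one>\<^bsub>K\<^esub> b)"

locale additive_category = category K
  for K :: "('o, 'm, 'x) preadditive_scheme" (structure) +
  assumes plus_closed: "\<lbrakk>f \<in> Hom K x y; g \<in> Hom K x y\<rbrakk> \<Longrightarrow> f \<oplus> g \<in> Hom K x y"
    and zero_closed: "\<lbrakk>x \<in> obj K; y \<in> obj K\<rbrakk> \<Longrightarrow> \<zero> x y \<in> Hom K x y"
    and neg_closed: "f \<in> Hom K x y \<Longrightarrow> \<ominus> f \<in> Hom K x y"
    and plus_assoc: "\<lbrakk>f \<in> Hom K x y; g \<in> Hom K x y; h \<in> Hom K x y\<rbrakk>
      \<Longrightarrow> (f \<oplus> g) \<oplus> h = f \<oplus> (g \<oplus> h)"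
    and plus_commute: "\<lbrakk>f \<in> Hom K x y; g \<in> Hom K x y\<rbrakk> \<Longrightarrow> f \<oplus> g = g \<oplus> f"
    and plus_zero: "f \<in> Hom K x y \<Longrightarrow> f \<oplus> \<zero> x y = f"
    and plus_neg: "f \<in> Hom K x y \<Longrightarrow> f \<oplus> (\<ominus> f) = \<zero> x y"
    and comp_plus_left: "\<lbrakk>f \<in> Hom K x y; g \<in> Hom K y z; g' \<in> Hom K y z\<rbrakk>
      \<Longrightarrow> (g \<oplus> g') \<cdot> f = (g \<cdot> f) \<oplus> (g' \<cdot> f)"
    and comp_plus_right: "\<lbrakk>f \<in> Hom K x y; f' \<in> Hom K x y; g \<in> Hom K y z\<rbrakk>
      \<Longrightarrow> g \<cdot> (f \<oplus> f') = (g \<cdot> f) \<oplus> (g \<cdot> f')"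
    and zero_object_exists: "\<exists>z. zero_object K z"
    and biproduct_exists: "\<lbrakk>x \<in> obj K; y \<in> obj K\<rbrakk> \<Longrightarrow> \<exists>b. is_biproduct K x y b"

definition additive_endofunctor ::
    "('o, 'm, 'x) preadditive_scheme \<Rightarrow> ('o \<Rightarrow> 'o) \<Rightarrow> ('m \<Rightarrow> 'm) \<Rightarrow> bool" where
  "additive_endofunctor K F Fm \<longleftrightarrow>
     (\<forall>x \<in> obj K. F x \<in> obj K \<and> Fm (\<one>\<^bsub>K\<^esub> x) = \<one>\<^bsub>K\<^esub> (F x)) \<and>
     (\<forall>x y. \<forall>f \<in> Hom K x y. Fm f \<in> Hom K (F x) (F y)) \<and>
     (\<forall>x y z. \<forall>f \<in> Hom K x y. \<forall>g \<in> Hom K y z. Fm (g \<cdot>\<^bsub>K\<^esub> f) = Fm g \<cdot>\<^bsub>K\<^esub> Fm f) \<and>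
     (\<forall>x y. \<forall>f \<in> Hom K x y. \<forall>g \<in> Hom K x y. Fm (f \<oplus>\<^bsub>K\<^esub> g) = Fm f \<oplus>\<^bsub>K\<^esub> Fm g)"


section \<open>Triangulated categories\<close>

text \<open>
  A triangle \<open>x \<rightarrow> y \<rightarrow> z \<rightarrow> \<Sigma>x\<close> is represented by its three arrows; \<open>dtri\<close> singles out the
  distinguished ones. The suspension is an additive autoequivalence, not necessarily an
  automorphism.
\<close>

record ('o, 'm) triangulated = "('o, 'm) preadditive" +
  shift :: "'o \<Rightarrow> 'o" ("\<Sigma>\<index>")
  shift_arr :: "'m \<Rightarrow> 'm" ("\<Sigma>\<^sub>m\<index>")
  dtri :: "'m \<Rightarrow> 'm \<Rightarrow> 'm \<Rightarrow> bool"

definition triangle ::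
    "('o, 'm, 'x) triangulated_scheme \<Rightarrow> 'o \<Rightarrow> 'o \<Rightarrow> 'o \<Rightarrow> 'm \<Rightarrow> 'm \<Rightarrow> 'm \<Rightarrow> bool" where
  "triangle K x y z f g h \<longleftrightarrow>
     f \<in> Hom K x y \<and> g \<in> Hom K y z \<and> h \<in> Hom K z (\<Sigma>\<^bsub>K\<^esub> x)"

definition dist_triangle ::
    "('o, 'm, 'x) triangulated_scheme \<Rightarrow> 'o \<Rightarrow> 'o \<Rightarrow> 'o \<Rightarrow> 'm \<Rightarrow> 'm \<Rightarrow> 'm \<Rightarrow> bool" where
  "dist_triangle K x y z f g h \<longleftrightarrow> triangle K x y z f g h \<and> dtri K f g h"

locale triangulated_category = additive_category K
  for K :: "('o, 'm, 'x) triangulated_scheme" (structure) +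
  assumes shift_functor: "additive_endofunctor K \<Sigma> \<Sigma>\<^sub>m"
    and shift_fully_faithful:
      "\<lbrakk>x \<in> obj K; y \<in> obj K\<rbrakk> \<Longrightarrow> bij_betw \<Sigma>\<^sub>m (Hom K x y) (Hom K (\<Sigma> x) (\<Sigma> y))"
    and shift_ess_surj: "y \<in> obj K \<Longrightarrow> \<exists>x \<in> obj K. isomorphic K (\<Sigma> x) y"
    and TR1_iso:
      "\<lbrakk>dist_triangle K x y z f g h; triangle K x' y' z' f' g' h';
        iso_arr K x x' a; iso_arr K y y' b; iso_arr K z z' c;
        b \<cdot> f = f' \<cdot> a; c \<cdot> g = g' \<cdot> b; \<Sigma>\<^sub>m a \<cdot> h = h' \<cdot> c\<rbrakk>
       \<Longrightarrow> dist_triangle K x' y' z' f' g' h'"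
    and TR1_idt:
      "\<lbrakk>x \<in> obj K; zero_object K z\<rbrakk>
       \<Longrightarrow> dist_triangle K x x z (\<one> x) (\<zero> x z) (\<zero> z (\<Sigma> x))"
    and TR1_cone:
      "f \<in> Hom K x y \<Longrightarrow> \<exists>z g h. dist_triangle K x y z f g h"
    and TR2:
      "triangle K x y z f g h
       \<Longrightarrow> dist_triangle K x y z f g h \<longleftrightarrow> dist_triangle K y z (\<Sigma> x) g h (\<ominus> (\<Sigma>\<^sub>m f))"
    and TR3:
      "\<lbrakk>dist_triangle K x y z f g h; dist_triangle K x' y' z' f' g' h';
        a \<in> Hom K x x'; b \<in> Hom K y y'; b \<cdot> f = f' \<cdot> a\<rbrakk>
       \<Longrightarrow> \<exists>c \<in> Hom K z z'. c \<cdot> g = g' \<cdot> b \<and> \<Sigma>\<^sub>m a \<cdot> h = h' \<cdot> c"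
    and TR4:
      "\<lbrakk>dist_triangle K x y u f f' f''; dist_triangle K y z v g g' g'';
        dist_triangle K x z w (g \<cdot> f) h' h''\<rbrakk>
       \<Longrightarrow> \<exists>a b. dist_triangle K u w v a b (\<Sigma>\<^sub>m f' \<cdot> g'') \<and>
             a \<cdot> f' = h' \<cdot> g \<and> h'' \<cdot> a = f'' \<and>
             b \<cdot> h' = g' \<and> g'' \<cdot> b = \<Sigma>\<^sub>m f \<cdot> h''"

definition exact_endofunctor ::
    "('o, 'm, 'x) triangulated_scheme \<Rightarrow> ('o \<Rightarrow> 'o) \<Rightarrow> ('m \<Rightarrow> 'm) \<Rightarrow> bool" where
  "exact_endofunctor K F Fm \<longleftrightarrow> additive_endofunctor K F Fm \<and>
     (\<exists>\<phi>. (\<forall>x \<in> obj K. iso_arr K (F (\<Sigma>\<^bsub>K\<^esub> x)) (\<Sigma>\<^bsub>K\<^esub> (F x)) (\<phi> x)) \<and>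
          (\<forall>x y. \<forall>f \<in> Hom K x y.
             \<phi> y \<cdot>\<^bsub>K\<^esub> Fm (\<Sigma>\<^sub>m\<^bsub>K\<^esub> f) = \<Sigma>\<^sub>m\<^bsub>K\<^esub> (Fm f) \<cdot>\<^bsub>K\<^esub> \<phi> x) \<and>
          (\<forall>x y z f g h. dist_triangle K x y z f g h \<longrightarrow>
             dist_triangle K (F x) (F y) (F z) (Fm f) (Fm g) (\<phi> x \<cdot>\<^bsub>K\<^esub> Fm h)))"


section \<open>Tensor triangulated categories\<close>

record ('o, 'm) tensor_triangulated = "('o, 'm) triangulated" +
  tensor :: "'o \<Rightarrow> 'o \<Rightarrow> 'o" (infixr "\<otimes>\<index>" 70)
  tensor_arr :: "'m \<Rightarrow> 'm \<Rightarrow> 'm" (infixr "\<otimes>\<^sub>m\<index>" 70)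
  tunit :: 'o
  associator :: "'o \<Rightarrow> 'o \<Rightarrow> 'o \<Rightarrow> 'm"
  lunitor :: "'o \<Rightarrow> 'm"
  runitor :: "'o \<Rightarrow> 'm"
  braiding :: "'o \<Rightarrow> 'o \<Rightarrow> 'm"

locale symmetric_monoidal_category = category K
  for K :: "('o, 'm, 'x) tensor_triangulated_scheme" (structure) +
  assumes tensor_closed: "\<lbrakk>x \<in> obj K; y \<in> obj K\<rbrakk> \<Longrightarrow> x \<otimes> y \<in> obj K"
    and tensor_arr_closed: "\<lbrakk>f \<in> Hom K x x'; g \<in> Hom K y y'\<rbrakk>
      \<Longrightarrow> f \<otimes>\<^sub>m g \<in> Hom K (x \<otimes> y) (x' \<otimes> y')"
    and tensor_idt: "\<lbrakk>x \<in> obj K; y \<in> obj K\<rbrakk> \<Longrightarrow> \<one> x \<otimes>\<^sub>m \<one> y = \<one> (x \<otimes> y)"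
    and tensor_comp: "\<lbrakk>f \<in> Hom K x x'; f' \<in> Hom K x' x''; g \<in> Hom K y y'; g' \<in> Hom K y' y''\<rbrakk>
      \<Longrightarrow> (f' \<cdot> f) \<otimes>\<^sub>m (g' \<cdot> g) = (f' \<otimes>\<^sub>m g') \<cdot> (f \<otimes>\<^sub>m g)"
    and tunit_closed: "tunit K \<in> obj K"
    and associator_iso: "\<lbrakk>x \<in> obj K; y \<in> obj K; z \<in> obj K\<rbrakk>
      \<Longrightarrow> iso_arr K ((x \<otimes> y) \<otimes> z) (x \<otimes> (y \<otimes> z)) (associator K x y z)"
    and associator_natural: "\<lbrakk>f \<in> Hom K x x'; g \<in> Hom K y y'; h \<in> Hom K z z'\<rbrakk>
      \<Longrightarrow> associator K x' y' z' \<cdot> ((f \<otimes>\<^sub>m g) \<otimes>\<^sub>m h) = (f \<otimes>\<^sub>m (g \<otimes>\<^sub>m h)) \<cdot> associator K x y z"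
    and lunitor_iso: "x \<in> obj K \<Longrightarrow> iso_arr K (tunit K \<otimes> x) x (lunitor K x)"
    and lunitor_natural: "f \<in> Hom K x y
      \<Longrightarrow> lunitor K y \<cdot> (\<one> (tunit K) \<otimes>\<^sub>m f) = f \<cdot> lunitor K x"
    and runitor_iso: "x \<in> obj K \<Longrightarrow> iso_arr K (x \<otimes> tunit K) x (runitor K x)"
    and runitor_natural: "f \<in> Hom K x y
      \<Longrightarrow> runitor K y \<cdot> (f \<otimes>\<^sub>m \<one> (tunit K)) = f \<cdot> runitor K x"
    and braiding_iso: "\<lbrakk>x \<in> obj K; y \<in> obj K\<rbrakk>
      \<Longrightarrow> iso_arr K (x \<otimes> y) (y \<otimes> x) (braiding K x y)"
    and braiding_natural: "\<lbrakk>f \<in> Hom K x x'; g \<in> Hom K y y'\<rbrakk>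
      \<Longrightarrow> braiding K x' y' \<cdot> (f \<otimes>\<^sub>m g) = (g \<otimes>\<^sub>m f) \<cdot> braiding K x y"
    and pentagon: "\<lbrakk>w \<in> obj K; x \<in> obj K; y \<in> obj K; z \<in> obj K\<rbrakk>
      \<Longrightarrow> associator K w x (y \<otimes> z) \<cdot> associator K (w \<otimes> x) y z
        = (\<one> w \<otimes>\<^sub>m associator K x y z) \<cdot> associator K w (x \<otimes> y) z
          \<cdot> (associator K w x y \<otimes>\<^sub>m \<one> z)"
    and unit_coherence: "\<lbrakk>x \<in> obj K; y \<in> obj K\<rbrakk>
      \<Longrightarrow> (\<one> x \<otimes>\<^sub>m lunitor K y) \<cdot> associator K x (tunit K) y = runitor K x \<otimes>\<^sub>m \<one> y"
    and hexagon: "\<lbrakk>x \<in> obj K; y \<in> obj K; z \<in> obj K\<rbrakk>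
      \<Longrightarrow> associator K y z x \<cdot> braiding K x (y \<otimes> z) \<cdot> associator K x y z
        = (\<one> y \<otimes>\<^sub>m braiding K x z) \<cdot> associator K y x z \<cdot> (braiding K x y \<otimes>\<^sub>m \<one> z)"
    and braiding_symmetric: "\<lbrakk>x \<in> obj K; y \<in> obj K\<rbrakk>
      \<Longrightarrow> braiding K y x \<cdot> braiding K x y = \<one> (x \<otimes> y)"

locale tt_category = triangulated_category K + symmetric_monoidal_category K
  for K :: "('o, 'm, 'x) tensor_triangulated_scheme" (structure) +
  assumes tensor_exact_right:
      "x \<in> obj K \<Longrightarrow> exact_endofunctor K (\<lambda>y. x \<otimes> y) (\<lambda>f. \<one> x \<otimes>\<^sub>m f)"
    and tensor_exact_left:
      "y \<in> obj K \<Longrightarrow> exact_endofunctor K (\<lambda>x. x \<otimes> y) (\<lambda>f. f \<otimes>\<^sub>m \<one> y)"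

fun tensor_power :: "('o, 'm, 'x) tensor_triangulated_scheme \<Rightarrow> 'o \<Rightarrow> nat \<Rightarrow> 'o" where
  "tensor_power K x 0 = tunit K"
| "tensor_power K x (Suc 0) = x"
| "tensor_power K x (Suc (Suc n)) = x \<otimes>\<^bsub>K\<^esub> tensor_power K x (Suc n)"


section \<open>Ideals\<close>

text \<open>Full subcategories are identified with their sets of objects.\<close>

definition triangulated_subcategory ::
    "('o, 'm, 'x) triangulated_scheme \<Rightarrow> 'o set \<Rightarrow> bool" where
  "triangulated_subcategory K S \<longleftrightarrow> S \<subseteq> obj K \<and>
     (\<forall>z. zero_object K z \<longrightarrow> z \<in> S) \<and>
     (\<forall>x y b. x \<in> S \<and> y \<in> S \<and> is_biproduct K x y b \<longrightarrow> b \<in> S) \<and>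
     (\<forall>x y. x \<in> S \<and> isomorphic K x y \<longrightarrow> y \<in> S) \<and>
     (\<forall>x \<in> obj K. \<Sigma>\<^bsub>K\<^esub> x \<in> S \<longleftrightarrow> x \<in> S) \<and>
     (\<forall>x y z f g h. dist_triangle K x y z f g h \<and> x \<in> S \<and> y \<in> S \<longrightarrow> z \<in> S)"

definition tt_ideal :: "('o, 'm, 'x) tensor_triangulated_scheme \<Rightarrow> 'o set \<Rightarrow> bool" where
  "tt_ideal K I \<longleftrightarrow> triangulated_subcategory K I \<and>
     (\<forall>x y b. is_biproduct K x y b \<and> b \<in> I \<longrightarrow> x \<in> I \<and> y \<in> I) \<and>
     (\<forall>x \<in> I. \<forall>y \<in> obj K. x \<otimes>\<^bsub>K\<^esub> y \<in> I \<and> y \<otimes>\<^bsub>K\<^esub> x \<in> I)"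

definition ideal_generated ::
    "('o, 'm, 'x) tensor_triangulated_scheme \<Rightarrow> 'o set \<Rightarrow> 'o set" where
  "ideal_generated K X = \<Inter>{I. tt_ideal K I \<and> X \<subseteq> I}"

definition tt_radical :: "('o, 'm, 'x) tensor_triangulated_scheme \<Rightarrow> 'o set \<Rightarrow> 'o set" where
  "tt_radical K I = {x \<in> obj K. \<exists>n \<ge> 1. tensor_power K x n \<in> I}"

definition radical_ideal :: "('o, 'm, 'x) tensor_triangulated_scheme \<Rightarrow> 'o set \<Rightarrow> bool" where
  "radical_ideal K I \<longleftrightarrow> tt_ideal K I \<and> tt_radical K I = I"

definition finitely_generated_radical ::
    "('o, 'm, 'x) tensor_triangulated_scheme \<Rightarrow> 'o set \<Rightarrow> bool" where
  "finitely_generated_radical K I \<longleftrightarrow>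
     (\<exists>X. finite X \<and> X \<subseteq> obj K \<and> I = tt_radical K (ideal_generated K X))"

definition prime_ideal :: "('o, 'm, 'x) tensor_triangulated_scheme \<Rightarrow> 'o set \<Rightarrow> bool" where
  "prime_ideal K P \<longleftrightarrow> tt_ideal K P \<and> P \<noteq> obj K \<and>
     (\<forall>x \<in> obj K. \<forall>y \<in> obj K. x \<otimes>\<^bsub>K\<^esub> y \<in> P \<longrightarrow> x \<in> P \<or> y \<in> P)"


section \<open>The Balmer spectrum\<close>

definition Spc :: "('o, 'm, 'x) tensor_triangulated_scheme \<Rightarrow> 'o set set" where
  "Spc K = {P. prime_ideal K P}"

definition supp :: "('o, 'm, 'x) tensor_triangulated_scheme \<Rightarrow> 'o \<Rightarrow> 'o set set" where
  "supp K x = {P \<in> Spc K. x \<notin> P}"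

definition Spc_topology :: "('o, 'm, 'x) tensor_triangulated_scheme \<Rightarrow> 'o set topology" where
  "Spc_topology K =
     topology (arbitrary union_of (\<lambda>U. \<exists>x \<in> obj K. U = Spc K - supp K x))"

text \<open>
  The constant \<^const>\<open>topology\<close> is meaningful only on predicates satisfying \<^const>\<open>istopology\<close>;
  the following lemmas check this side condition.
\<close>

context tt_category
begin

lemma istopology_Spc:
  "istopology (arbitrary union_of (\<lambda>U. \<exists>x \<in> obj K. U = Spc K - supp K x))"
proof (rule istopology_base)
  fix S T
  assume "\<exists>x \<in> obj K. S = Spc K - supp K x" and "\<exists>x \<in> obj K. T = Spc K - supp K x"
  then obtain x y where x: "x \<in> obj K" "S = Spc K - supp K x"
    and y: "y \<in> obj K" "T = Spc K - supp K y" by blast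
  obtain b where b: "is_biproduct K x y b" using biproduct_exists x(1) y(1) by blast
  have "b \<in> P \<longleftrightarrow> x \<in> P \<and> y \<in> P" if "P \<in> Spc K" for P
  proof -
    have P: "tt_ideal K P" using that by (simp add: Spc_def prime_ideal_def)
    have "\<forall>x y b. x \<in> P \<and> y \<in> P \<and> is_biproduct K x y b \<longrightarrow> b \<in> P"
      using P unfolding tt_ideal_def triangulated_subcategory_def by (elim conjE)
    moreover have "\<forall>x y b. is_biproduct K x y b \<and> b \<in> P \<longrightarrow> x \<in> P \<and> y \<in> P"
      using P unfolding tt_ideal_def by (elim conjE)
    ultimately show ?thesis using b by meson
  qed
  then have "S \<inter> T = Spc K - supp K b"
    unfolding x(2) y(2) supp_def by auto
  moreover have "b \<in> obj K" using b by (simp add: is_biproduct_def)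
  ultimately show "\<exists>x \<in> obj K. S \<inter> T = Spc K - supp K x" by blast
qed

lemma openin_Spc_topology:
  "openin (Spc_topology K) =
     arbitrary union_of (\<lambda>U. \<exists>x \<in> obj K. U = Spc K - supp K x)"
  unfolding Spc_topology_def using istopology_Spc by (rule topology_inverse')

lemma topspace_Spc_topology: "topspace (Spc_topology K) = Spc K"
proof
  show "topspace (Spc_topology K) \<subseteq> Spc K"
    unfolding topspace_def openin_Spc_topology by (auto simp: union_of_def arbitrary_def)
  obtain z where z: "zero_object K z" using zero_object_exists by blast
  then have "z \<in> obj K" by (simp add: zero_object_def)
  have "z \<in> P" if "P \<in> Spc K" for P
  proof -
    have "\<forall>z. zero_object K z \<longrightarrow> z \<in> P"
      using that unfolding Spc_def mem_Collect_eq prime_ideal_def tt_ideal_def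
        triangulated_subcategory_def by (elim conjE)
    then show ?thesis using z by blast
  qed
  then have "Spc K = Spc K - supp K z" by (auto simp: supp_def)
  then have "openin (Spc_topology K) (Spc K)"
    unfolding openin_Spc_topology using \<open>z \<in> obj K\<close>
    by (intro arbitrary_union_of_inc) (rule bexI[of _ z])
  then show "Spc K \<subseteq> topspace (Spc_topology K)" by (rule openin_subset)
qed

end


section \<open>Thomason subsets and weakly Noetherian spaces\<close>

definition Thomason :: "'a topology \<Rightarrow> 'a set \<Rightarrow> bool" where
  "Thomason X W \<longleftrightarrow>
     (\<exists>\<U>. (\<forall>U \<in> \<U>. openin X U \<and> compactin X U) \<and> W = (\<Union>U \<in> \<U>. topspace X - U))"

definition weakly_visible :: "'a topology \<Rightarrow> 'a set \<Rightarrow> bool" where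
  "weakly_visible X V \<longleftrightarrow>
     (\<exists>W\<^sub>1 W\<^sub>2. Thomason X W\<^sub>1 \<and> Thomason X W\<^sub>2 \<and> V = W\<^sub>1 \<inter> (topspace X - W\<^sub>2))"

definition weakly_Noetherian :: "'a topology \<Rightarrow> bool" where
  "weakly_Noetherian X \<longleftrightarrow> (\<forall>x \<in> topspace X. weakly_visible X {x})"

end

theory Submission
  imports Defs
begin

text \<open>
  For an ideal \<open>J\<close> the intersection of the primes above \<open>J\<close> is contained in the radical of \<open>J\<close>:
  an ideal maximal among those containing \<open>J\<close> and no power of \<open>x\<close> is prime. If the spectrum
  is finite, finitely many objects of a radical ideal \<open>I\<close> therefore suffice to cut out the same
  primes as \<open>I\<close>.

  Conversely, if radical ideals are finitely generated and the spectrum is infinite, there is a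
  radical ideal \<open>R\<close> maximal among those with infinitely many primes above it, and \<open>R\<close> is prime.
  Weak visibility of the point \<open>R\<close> gives finitely many objects outside \<open>R\<close> such that every prime
  properly containing \<open>R\<close> contains one of them. One of these objects lies in infinitely many primes
  above \<open>R\<close>, whose intersection contradicts the maximality of \<open>R\<close>.
\<close>

section \<open>Additive functors\<close>

lemma (in category) Hom_obj:
  "f \<in> Hom K x y \<Longrightarrow> x \<in> obj K" "f \<in> Hom K x y \<Longrightarrow> y \<in> obj K"
  using src_closed tgt_closed unfolding Hom_def by auto

lemma (in category) isomorphic_obj:
  "isomorphic K x y \<Longrightarrow> x \<in> obj K" "isomorphic K x y \<Longrightarrow> y \<in> obj K"
  unfolding isomorphic_def iso_arr_def using Hom_obj by blast+

lemma isomorphic_sym: "isomorphic K x y \<Longrightarrow> isomorphic K y x"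
  unfolding isomorphic_def iso_arr_def by blast

lemma (in category) isomorphic_trans:
  assumes "isomorphic K x y" "isomorphic K y z"
  shows "isomorphic K x z"
proof -
  obtain f f' where f: "f \<in> Hom K x y" "f' \<in> Hom K y x" "f' \<cdot> f = \<one> x" "f \<cdot> f' = \<one> y"
    using assms(1) unfolding isomorphic_def iso_arr_def by blast
  obtain g g' where g: "g \<in> Hom K y z" "g' \<in> Hom K z y" "g' \<cdot> g = \<one> y" "g \<cdot> g' = \<one> z"
    using assms(2) unfolding isomorphic_def iso_arr_def by blast
  have gf: "g \<cdot> f \<in> Hom K x z" and fg: "f' \<cdot> g' \<in> Hom K z x"
    using f g comp_closed by blast+
  have "(f' \<cdot> g') \<cdot> (g \<cdot> f) = f' \<cdot> ((g' \<cdot> g) \<cdot> f)"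
    using comp_assoc[OF gf g(2) f(2)] comp_assoc[OF f(1) g(1) g(2)] by simp
  also have "\<dots> = \<one> x" using f g comp_idt_left by simp
  finally have 1: "(f' \<cdot> g') \<cdot> (g \<cdot> f) = \<one> x" .
  have "(g \<cdot> f) \<cdot> (f' \<cdot> g') = g \<cdot> ((f \<cdot> f') \<cdot> g')"
    using comp_assoc[OF fg f(1) g(1)] comp_assoc[OF g(2) f(2) f(1)] by simp
  also have "\<dots> = \<one> z" using f g comp_idt_left by simp
  finally have 2: "(g \<cdot> f) \<cdot> (f' \<cdot> g') = \<one> z" .
  show ?thesis unfolding isomorphic_def iso_arr_def using gf fg 1 2 by blast
qed

context additive_category
begin

text \<open>Cancellation of one copy of \<open>h\<close> by its negative. Bilinearity of composition
  and additivity of functors speak of sums only; this is how composites and images of zero arrows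
  are recognised as zero.\<close>

lemma plus_self_eq_zero:
  assumes h: "h \<in> Hom K x y" and "h \<oplus> h = h"
  shows "h = \<zero> x y"
  using plus_assoc[OF h h neg_closed[OF h]] plus_zero[OF h] plus_neg[OF h] assms(2) by simp

lemma zero_arr_Hom: "\<lbrakk>x \<in> obj K; y \<in> obj K\<rbrakk> \<Longrightarrow> \<zero> x y \<oplus> \<zero> x y = \<zero> x y"
  using plus_zero zero_closed by blast

lemma comp_zero_left:
  assumes f: "f \<in> Hom K x y" and "z \<in> obj K"
  shows "\<zero> y z \<cdot> f = \<zero> x z"
proof (rule plus_self_eq_zero)
  have 0: "\<zero> y z \<in> Hom K y z" using Hom_obj f assms(2) zero_closed by blast
  then show "\<zero> y z \<cdot> f \<in> Hom K x z" using f comp_closed by blast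
  show "\<zero> y z \<cdot> f \<oplus> \<zero> y z \<cdot> f = \<zero> y z \<cdot> f"
    using comp_plus_left[OF f 0 0] zero_arr_Hom[of y z] Hom_obj f assms(2) by metis
qed

lemma comp_zero_right:
  assumes g: "g \<in> Hom K y z" and "x \<in> obj K"
  shows "g \<cdot> \<zero> x y = \<zero> x z"
proof (rule plus_self_eq_zero)
  have 0: "\<zero> x y \<in> Hom K x y" using Hom_obj g assms(2) zero_closed by blast
  then show "g \<cdot> \<zero> x y \<in> Hom K x z" using g comp_closed by blast
  show "g \<cdot> \<zero> x y \<oplus> g \<cdot> \<zero> x y = g \<cdot> \<zero> x y"
    using comp_plus_right[OF 0 0 g] zero_arr_Hom[of x y] Hom_obj g assms(2) by metis
qed

end

lemma additive_endofunctorD: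
  assumes "additive_endofunctor K F Fm"
  shows "x \<in> obj K \<Longrightarrow> F x \<in> obj K"
    and "x \<in> obj K \<Longrightarrow> Fm (\<one>\<^bsub>K\<^esub> x) = \<one>\<^bsub>K\<^esub> (F x)"
    and "f \<in> Hom K x y \<Longrightarrow> Fm f \<in> Hom K (F x) (F y)"
    and "\<lbrakk>f \<in> Hom K x y; g \<in> Hom K y z\<rbrakk> \<Longrightarrow> Fm (g \<cdot>\<^bsub>K\<^esub> f) = Fm g \<cdot>\<^bsub>K\<^esub> Fm f"
    and "\<lbrakk>f \<in> Hom K x y; f' \<in> Hom K x y\<rbrakk> \<Longrightarrow> Fm (f \<oplus>\<^bsub>K\<^esub> f') = Fm f \<oplus>\<^bsub>K\<^esub> Fm f'"
  using assms unfolding additive_endofunctor_def by blast+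

lemma additive_endofunctor_isomorphic:
  assumes F: "additive_endofunctor K F Fm" and "category K" and "isomorphic K x y"
  shows "isomorphic K (F x) (F y)"
proof -
  obtain f g where f: "f \<in> Hom K x y" "g \<in> Hom K y x" "g \<cdot>\<^bsub>K\<^esub> f = \<one>\<^bsub>K\<^esub> x" "f \<cdot>\<^bsub>K\<^esub> g = \<one>\<^bsub>K\<^esub> y"
    using assms(3) unfolding isomorphic_def iso_arr_def by blast
  note D = additive_endofunctorD[OF F]
  have "x \<in> obj K" "y \<in> obj K" using f(1) category.Hom_obj[OF assms(2)] by blast+
  then have "Fm g \<cdot>\<^bsub>K\<^esub> Fm f = \<one>\<^bsub>K\<^esub> (F x)" "Fm f \<cdot>\<^bsub>K\<^esub> Fm g = \<one>\<^bsub>K\<^esub> (F y)"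
    using f D(2) D(4)[OF f(1,2)] D(4)[OF f(2,1)] by simp_all
  then show ?thesis
    unfolding isomorphic_def iso_arr_def using D(3) f(1,2) by blast
qed

context additive_category
begin

lemma additive_endofunctor_zero_arr:
  assumes F: "additive_endofunctor K F Fm" and xy: "x \<in> obj K" "y \<in> obj K"
  shows "Fm (\<zero> x y) = \<zero> (F x) (F y)"
  using additive_endofunctorD(3,5)[OF F] zero_closed[OF xy] zero_arr_Hom[OF xy]
  by (metis plus_self_eq_zero)

text \<open>An object whose identity is a zero arrow is a zero object, since every arrow into or out
  of it absorbs that identity; \<open>F\<close> carries the equation
  \<open>\<one> z = \<zero> z z\<close> over to \<open>F z\<close>.\<close>

lemma additive_endofunctor_zero_object:
  assumes F: "additive_endofunctor K F Fm" and z: "zero_object K z"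
  shows "zero_object K (F z)"
proof -
  note D = additive_endofunctorD[OF F]
  have zK: "z \<in> obj K" using z by (simp add: zero_object_def)
  then have FzK: "F z \<in> obj K" by (rule D(1))
  have "\<one> z = \<zero> z z" using z idt_closed[OF zK] zK unfolding zero_object_def by blast
  then have id0: "\<one> (F z) = \<zero> (F z) (F z)"
    using D(2)[OF zK] additive_endofunctor_zero_arr[OF F zK zK] by simp
  have "Hom K x (F z) = {\<zero> x (F z)}" if "x \<in> obj K" for x
    using that FzK id0 comp_zero_left comp_idt_left zero_closed by fastforce
  moreover have "Hom K (F z) x = {\<zero> (F z) x}" if "x \<in> obj K" for x
    using that FzK id0 comp_zero_right comp_idt_right zero_closed by fastforce
  ultimately show ?thesis using FzK unfolding zero_object_def by blast
qed

text \<open>A biproduct is described by equations between composites, sums, identities and zero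
  arrows, all of which an additive functor preserves.\<close>

lemma additive_endofunctor_biproduct:
  assumes F: "additive_endofunctor K F Fm" and b: "is_biproduct K x y b"
  shows "is_biproduct K (F x) (F y) (F b)"
proof -
  note D = additive_endofunctorD[OF F]
  obtain i j p q where xyb: "x \<in> obj K" "y \<in> obj K" "b \<in> obj K"
    and h: "i \<in> Hom K x b" "j \<in> Hom K y b" "p \<in> Hom K b x" "q \<in> Hom K b y"
    and e: "p \<cdot> i = \<one> x" "q \<cdot> j = \<one> y" "p \<cdot> j = \<zero> y x" "q \<cdot> i = \<zero> x y"
      "(i \<cdot> p) \<oplus> (j \<cdot> q) = \<one> b"
    using b unfolding is_biproduct_def by blast
  note Z = additive_endofunctor_zero_arr[OF F]
  have "Fm p \<cdot> Fm i = \<one> (F x)" using e(1) D(2,4) h xyb by metis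
  moreover have "Fm q \<cdot> Fm j = \<one> (F y)" using e(2) D(2,4) h xyb by metis
  moreover have "Fm p \<cdot> Fm j = \<zero> (F y) (F x)" using e(3) D(4) Z h xyb by metis
  moreover have "Fm q \<cdot> Fm i = \<zero> (F x) (F y)" using e(4) D(4) Z h xyb by metis
  moreover have "(Fm i \<cdot> Fm p) \<oplus> (Fm j \<cdot> Fm q) = \<one> (F b)"
    using e(5) D(4)[OF h(3,1)] D(4)[OF h(4,2)] D(2)[OF xyb(3)]
      D(5)[OF comp_closed[OF h(3,1)] comp_closed[OF h(4,2)]] by simp
  ultimately show ?thesis
    unfolding is_biproduct_def using D(1) D(3) xyb h by blast
qed

end

section \<open>Ideals\<close>

lemma tt_idealD:
  assumes "tt_ideal K I"
  shows "I \<subseteq> obj K"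
    and "zero_object K z \<Longrightarrow> z \<in> I"
    and "\<lbrakk>x \<in> I; y \<in> I; is_biproduct K x y b\<rbrakk> \<Longrightarrow> b \<in> I"
    and "\<lbrakk>isomorphic K x y; x \<in> I\<rbrakk> \<Longrightarrow> y \<in> I"
    and "x \<in> obj K \<Longrightarrow> \<Sigma>\<^bsub>K\<^esub> x \<in> I \<longleftrightarrow> x \<in> I"
    and "\<lbrakk>dist_triangle K x y z f g h; x \<in> I; y \<in> I\<rbrakk> \<Longrightarrow> z \<in> I"
    and "\<lbrakk>is_biproduct K x y b; b \<in> I\<rbrakk> \<Longrightarrow> x \<in> I"
    and "\<lbrakk>is_biproduct K x y b; b \<in> I\<rbrakk> \<Longrightarrow> y \<in> I"
    and "\<lbrakk>x \<in> I; y \<in> obj K\<rbrakk> \<Longrightarrow> x \<otimes>\<^bsub>K\<^esub> y \<in> I"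
    and "\<lbrakk>x \<in> I; y \<in> obj K\<rbrakk> \<Longrightarrow> y \<otimes>\<^bsub>K\<^esub> x \<in> I"
proof -
  note * = assms[unfolded tt_ideal_def triangulated_subcategory_def]
  show "I \<subseteq> obj K" using * by (elim conjE)
  show "zero_object K z \<Longrightarrow> z \<in> I" using * by (elim conjE) blast
  have "\<forall>x y b. x \<in> I \<and> y \<in> I \<and> is_biproduct K x y b \<longrightarrow> b \<in> I" using * by (elim conjE)
  then show "\<lbrakk>x \<in> I; y \<in> I; is_biproduct K x y b\<rbrakk> \<Longrightarrow> b \<in> I" by blast
  have "\<forall>x y. x \<in> I \<and> isomorphic K x y \<longrightarrow> y \<in> I" using * by (elim conjE)
  then show "\<lbrakk>isomorphic K x y; x \<in> I\<rbrakk> \<Longrightarrow> y \<in> I" by blast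
  have "\<forall>x \<in> obj K. \<Sigma>\<^bsub>K\<^esub> x \<in> I \<longleftrightarrow> x \<in> I" using * by (elim conjE)
  then show "x \<in> obj K \<Longrightarrow> \<Sigma>\<^bsub>K\<^esub> x \<in> I \<longleftrightarrow> x \<in> I" by blast
  have "\<forall>x y z f g h. dist_triangle K x y z f g h \<and> x \<in> I \<and> y \<in> I \<longrightarrow> z \<in> I"
    using * by (elim conjE)
  then show "\<lbrakk>dist_triangle K x y z f g h; x \<in> I; y \<in> I\<rbrakk> \<Longrightarrow> z \<in> I" by blast
  have "\<forall>x y b. is_biproduct K x y b \<and> b \<in> I \<longrightarrow> x \<in> I \<and> y \<in> I" using * by (elim conjE)
  then show "\<lbrakk>is_biproduct K x y b; b \<in> I\<rbrakk> \<Longrightarrow> x \<in> I"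
    and "\<lbrakk>is_biproduct K x y b; b \<in> I\<rbrakk> \<Longrightarrow> y \<in> I" by blast+
  have "\<forall>x \<in> I. \<forall>y \<in> obj K. x \<otimes>\<^bsub>K\<^esub> y \<in> I \<and> y \<otimes>\<^bsub>K\<^esub> x \<in> I" using * by (elim conjE)
  then show "\<lbrakk>x \<in> I; y \<in> obj K\<rbrakk> \<Longrightarrow> x \<otimes>\<^bsub>K\<^esub> y \<in> I"
    and "\<lbrakk>x \<in> I; y \<in> obj K\<rbrakk> \<Longrightarrow> y \<otimes>\<^bsub>K\<^esub> x \<in> I" by blast+
qed

lemma tt_idealI:
  assumes "I \<subseteq> obj K"
    and "\<And>z. zero_object K z \<Longrightarrow> z \<in> I"
    and "\<And>x y b. \<lbrakk>x \<in> I; y \<in> I; is_biproduct K x y b\<rbrakk> \<Longrightarrow> b \<in> I"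
    and "\<And>x y. \<lbrakk>isomorphic K x y; x \<in> I\<rbrakk> \<Longrightarrow> y \<in> I"
    and "\<And>x. x \<in> obj K \<Longrightarrow> \<Sigma>\<^bsub>K\<^esub> x \<in> I \<longleftrightarrow> x \<in> I"
    and "\<And>x y z f g h. \<lbrakk>dist_triangle K x y z f g h; x \<in> I; y \<in> I\<rbrakk> \<Longrightarrow> z \<in> I"
    and "\<And>x y b. \<lbrakk>is_biproduct K x y b; b \<in> I\<rbrakk> \<Longrightarrow> x \<in> I"
    and "\<And>x y b. \<lbrakk>is_biproduct K x y b; b \<in> I\<rbrakk> \<Longrightarrow> y \<in> I"
    and "\<And>x y. \<lbrakk>x \<in> I; y \<in> obj K\<rbrakk> \<Longrightarrow> x \<otimes>\<^bsub>K\<^esub> y \<in> I"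
    and "\<And>x y. \<lbrakk>x \<in> I; y \<in> obj K\<rbrakk> \<Longrightarrow> y \<otimes>\<^bsub>K\<^esub> x \<in> I"
  shows "tt_ideal K I"
proof -
  have "triangulated_subcategory K I"
    unfolding triangulated_subcategory_def
    by (intro conjI allI impI ballI; (elim conjE)?; rule assms; assumption)
  moreover have "\<forall>x y b. is_biproduct K x y b \<and> b \<in> I \<longrightarrow> x \<in> I \<and> y \<in> I"
    using assms(7,8) by blast
  moreover have "\<forall>x \<in> I. \<forall>y \<in> obj K. x \<otimes>\<^bsub>K\<^esub> y \<in> I \<and> y \<otimes>\<^bsub>K\<^esub> x \<in> I"
    using assms(9,10) by blast
  ultimately show ?thesis unfolding tt_ideal_def by blast
qed

text \<open>Each closure condition is inherited from the members. Nonemptiness gives the inclusion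
  in \<open>obj K\<close>, since \<open>\<Inter>{}\<close> is \<open>UNIV\<close>.\<close>

lemma tt_ideal_Inter:
  assumes "\<A> \<noteq> {}" and A: "\<And>I. I \<in> \<A> \<Longrightarrow> tt_ideal K I"
  shows "tt_ideal K (\<Inter>\<A>)"
proof (rule tt_idealI)
  show "\<Inter>\<A> \<subseteq> obj K" using assms(1) tt_idealD(1)[OF A] by blast
  show "\<Sigma>\<^bsub>K\<^esub> x \<in> \<Inter>\<A> \<longleftrightarrow> x \<in> \<Inter>\<A>" if "x \<in> obj K" for x
    using tt_idealD(5)[OF A that] by blast
  show "z \<in> \<Inter>\<A>" if "zero_object K z" for z
    using tt_idealD(2)[OF A that] by blast
  show "b \<in> \<Inter>\<A>" if "x \<in> \<Inter>\<A>" "y \<in> \<Inter>\<A>" "is_biproduct K x y b" for x y b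
    using tt_idealD(3)[OF A _ _ that(3)] that(1,2) by blast
  show "y \<in> \<Inter>\<A>" if "isomorphic K x y" "x \<in> \<Inter>\<A>" for x y
    using tt_idealD(4)[OF A that(1)] that(2) by blast
  show "z \<in> \<Inter>\<A>" if "dist_triangle K x y z f g h" "x \<in> \<Inter>\<A>" "y \<in> \<Inter>\<A>" for x y z f g h
    using tt_idealD(6)[OF A that(1)] that(2,3) by blast
  show "x \<in> \<Inter>\<A>" if "is_biproduct K x y b" "b \<in> \<Inter>\<A>" for x y b
    using tt_idealD(7)[OF A that(1)] that(2) by blast
  show "y \<in> \<Inter>\<A>" if "is_biproduct K x y b" "b \<in> \<Inter>\<A>" for x y b
    using tt_idealD(8)[OF A that(1)] that(2) by blast
  show "x \<otimes>\<^bsub>K\<^esub> y \<in> \<Inter>\<A>" if "x \<in> \<Inter>\<A>" "y \<in> obj K" for x y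
    using tt_idealD(9)[OF A _ that(2)] that(1) by blast
  show "y \<otimes>\<^bsub>K\<^esub> x \<in> \<Inter>\<A>" if "x \<in> \<Inter>\<A>" "y \<in> obj K" for x y
    using tt_idealD(10)[OF A _ that(2)] that(1) by blast
qed

lemma tt_ideal_Union_chain:
  assumes "\<A> \<noteq> {}" and A: "\<And>I. I \<in> \<A> \<Longrightarrow> tt_ideal K I" and chain: "subset.chain S \<A>"
  shows "tt_ideal K (\<Union>\<A>)"
proof -
  \<comment> \<open>Closure under biproducts and cones has two premises, which may come from
    different members of the chain; the larger member serves for both.\<close>
  have two: "\<exists>I \<in> \<A>. x \<in> I \<and> y \<in> I" if "x \<in> \<Union>\<A>" "y \<in> \<Union>\<A>" for x y
    using that chain unfolding subset_chain_def by blast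
  show ?thesis
  proof (rule tt_idealI)
    show "\<Sigma>\<^bsub>K\<^esub> x \<in> \<Union>\<A> \<longleftrightarrow> x \<in> \<Union>\<A>" if "x \<in> obj K" for x
      using tt_idealD(5)[OF A that] by blast
    show "b \<in> \<Union>\<A>" if "x \<in> \<Union>\<A>" "y \<in> \<Union>\<A>" "is_biproduct K x y b" for x y b
      using two[OF that(1,2)] tt_idealD(3)[OF A _ _ that(3)] by blast
    show "z \<in> \<Union>\<A>" if "dist_triangle K x y z f g h" "x \<in> \<Union>\<A>" "y \<in> \<Union>\<A>" for x y z f g h
      using two[OF that(2,3)] tt_idealD(6)[OF A that(1)] by blast
    show "z \<in> \<Union>\<A>" if "zero_object K z" for z
      using assms(1) tt_idealD(2)[OF A that] by blast
    show "\<Union>\<A> \<subseteq> obj K" using tt_idealD(1)[OF A] by blast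
    show "y \<in> \<Union>\<A>" if "isomorphic K x y" "x \<in> \<Union>\<A>" for x y
      using tt_idealD(4)[OF A that(1)] that(2) by blast
    show "x \<in> \<Union>\<A>" if "is_biproduct K x y b" "b \<in> \<Union>\<A>" for x y b
      using tt_idealD(7)[OF A that(1)] that(2) by blast
    show "y \<in> \<Union>\<A>" if "is_biproduct K x y b" "b \<in> \<Union>\<A>" for x y b
      using tt_idealD(8)[OF A that(1)] that(2) by blast
    show "x \<otimes>\<^bsub>K\<^esub> y \<in> \<Union>\<A>" if "x \<in> \<Union>\<A>" "y \<in> obj K" for x y
      using tt_idealD(9)[OF A _ that(2)] that(1) by blast
    show "y \<otimes>\<^bsub>K\<^esub> x \<in> \<Union>\<A>" if "x \<in> \<Union>\<A>" "y \<in> obj K" for x y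
      using tt_idealD(10)[OF A _ that(2)] that(1) by blast
  qed
qed

section \<open>Generated ideals and radicals\<close>

lemma ideal_generated_subset: "\<lbrakk>tt_ideal K I; X \<subseteq> I\<rbrakk> \<Longrightarrow> ideal_generated K X \<subseteq> I"
  unfolding ideal_generated_def by blast

lemma subset_ideal_generated: "X \<subseteq> ideal_generated K X"
  unfolding ideal_generated_def by blast

lemma tt_radical_mono: "I \<subseteq> J \<Longrightarrow> tt_radical K I \<subseteq> tt_radical K J"
  unfolding tt_radical_def by blast

lemma subset_tt_radical: "I \<subseteq> obj K \<Longrightarrow> I \<subseteq> tt_radical K I"
proof
  fix x assume "I \<subseteq> obj K" "x \<in> I"
  then show "x \<in> tt_radical K I"
    \<comment> \<open>Exponent one: \<open>tensor_power K x (Suc 0)\<close> is \<open>x\<close>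
      itself.\<close>
    unfolding tt_radical_def by (auto intro!: exI[of _ "Suc 0"])
qed

lemma radical_idealI:
  "\<lbrakk>tt_ideal K I; tt_radical K I \<subseteq> I\<rbrakk> \<Longrightarrow> radical_ideal K I"
  unfolding radical_ideal_def using subset_tt_radical[of I K] tt_idealD(1) by blast

lemma radical_ideal_Inter:
  assumes "\<A> \<noteq> {}" and A: "\<And>I. I \<in> \<A> \<Longrightarrow> radical_ideal K I"
  shows "radical_ideal K (\<Inter>\<A>)"
proof (rule radical_idealI)
  show "tt_ideal K (\<Inter>\<A>)"
    using assms by (intro tt_ideal_Inter) (auto simp: radical_ideal_def)
  have "tt_radical K (\<Inter>\<A>) \<subseteq> I" if "I \<in> \<A>" for I
    using A[OF that] tt_radical_mono[of "\<Inter>\<A>" I K] that unfolding radical_ideal_def by blast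
  then show "tt_radical K (\<Inter>\<A>) \<subseteq> \<Inter>\<A>" by blast
qed

text \<open>A power of \<open>x\<close> in the union lies in a single member, so the radical of the
  union is covered by the radicals of the members.\<close>

lemma radical_ideal_Union_chain:
  assumes "\<A> \<noteq> {}" and A: "\<And>I. I \<in> \<A> \<Longrightarrow> radical_ideal K I" and "subset.chain S \<A>"
  shows "radical_ideal K (\<Union>\<A>)"
proof (rule radical_idealI)
  show "tt_ideal K (\<Union>\<A>)"
    using assms by (intro tt_ideal_Union_chain) (auto simp: radical_ideal_def)
  have "tt_radical K (\<Union>\<A>) \<subseteq> (\<Union>I \<in> \<A>. tt_radical K I)"
    unfolding tt_radical_def by blast
  also have "\<dots> \<subseteq> \<Union>\<A>" using A unfolding radical_ideal_def by blast
  finally show "tt_radical K (\<Union>\<A>) \<subseteq> \<Union>\<A>" .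
qed

lemma prime_idealD:
  assumes "prime_ideal K P"
  shows "tt_ideal K P"
    and "\<lbrakk>x \<in> obj K; y \<in> obj K; x \<otimes>\<^bsub>K\<^esub> y \<in> P\<rbrakk> \<Longrightarrow> x \<in> P \<or> y \<in> P"
  using assms unfolding prime_ideal_def by blast+

section \<open>Existence of primes\<close>

context tt_category
begin

section \<open>Tensor products and powers up to isomorphism\<close>

lemma tensor_power_closed: "x \<in> obj K \<Longrightarrow> tensor_power K x n \<in> obj K"
proof (induction n)
  case (Suc n)
  then show ?case by (cases n) (simp_all add: tensor_closed)
qed (simp add: tunit_closed)

lemma tensor_assoc_isomorphic:
  "\<lbrakk>x \<in> obj K; y \<in> obj K; z \<in> obj K\<rbrakk> \<Longrightarrow> isomorphic K ((x \<otimes> y) \<otimes> z) (x \<otimes> (y \<otimes> z))"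
  unfolding isomorphic_def using associator_iso by blast

lemma tensor_commute_isomorphic:
  "\<lbrakk>x \<in> obj K; y \<in> obj K\<rbrakk> \<Longrightarrow> isomorphic K (x \<otimes> y) (y \<otimes> x)"
  unfolding isomorphic_def using braiding_iso by blast

lemma tensor_isomorphic_right:
  "\<lbrakk>x \<in> obj K; isomorphic K y z\<rbrakk> \<Longrightarrow> isomorphic K (x \<otimes> y) (x \<otimes> z)"
  using additive_endofunctor_isomorphic[of K "\<lambda>y. x \<otimes> y"] tensor_exact_right[of x]
    category_axioms unfolding exact_endofunctor_def by blast

text \<open>Powers are nested to the right, so regrouping needs the associator alone. Both exponents
  are successors: exponent zero gives the tensor unit and would bring in the unitors.\<close>

lemma tensor_power_Suc_add_isomorphic:
  assumes "x \<in> obj K"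
  shows "isomorphic K (tensor_power K x (Suc m) \<otimes> tensor_power K x (Suc n))
    (tensor_power K x (Suc m + Suc n))"
proof (induction m)
  case 0
  \<comment> \<open>\<open>x \<otimes> tensor_power K x (Suc n)\<close> is the next power by
    definition, so reflexivity of \<open>isomorphic\<close> suffices.\<close>
  have "tensor_power K x (Suc n + 1) \<in> obj K" using assms tensor_power_closed by blast
  then have "isomorphic K (tensor_power K x (Suc n + 1)) (tensor_power K x (Suc n + 1))"
    unfolding isomorphic_def iso_arr_def using idt_closed comp_idt_left by blast
  then show ?case by simp
next
  case (Suc m)
  note c = tensor_power_closed[OF assms]
  show ?case
    using isomorphic_trans[OF tensor_assoc_isomorphic[OF assms c[of "Suc m"] c[of "Suc n"]]
        tensor_isomorphic_right[OF assms Suc]] by simp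
qed

lemma tt_ideal_obj: "tt_ideal K (obj K)"
proof (rule tt_idealI)
  show "\<Sigma> x \<in> obj K \<longleftrightarrow> x \<in> obj K" if "x \<in> obj K" for x
    using that additive_endofunctorD(1)[OF shift_functor] by blast
  show "z \<in> obj K" if "dist_triangle K x y z f g h" for x y z f g h
    using that Hom_obj(2)[of g y z] unfolding dist_triangle_def triangle_def by blast
qed (auto simp: zero_object_def is_biproduct_def tensor_closed dest: isomorphic_obj)

text \<open>This is the ideal quotient of \<open>I\<close> by \<open>b\<close>, the preimage of
  \<open>I\<close> under the exact functor tensoring with \<open>b\<close>. Exactness transfers the
  triangulated conditions, symmetry and associativity the tensor conditions.\<close>

lemma tt_ideal_tensor_preimage:
  assumes I: "tt_ideal K I" and b: "b \<in> obj K"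
  shows "tt_ideal K {x \<in> obj K. x \<otimes> b \<in> I}" (is "tt_ideal K ?J")
proof -
  have F: "additive_endofunctor K (\<lambda>x. x \<otimes> b) (\<lambda>f. f \<otimes>\<^sub>m \<one> b)"
    using tensor_exact_left[OF b] unfolding exact_endofunctor_def by (elim conjE)
  obtain \<phi> where shift: "\<forall>x \<in> obj K. iso_arr K (\<Sigma> x \<otimes> b) (\<Sigma> (x \<otimes> b)) (\<phi> x)"
    and tri: "\<forall>x y z f g h. dist_triangle K x y z f g h \<longrightarrow>
      dist_triangle K (x \<otimes> b) (y \<otimes> b) (z \<otimes> b) (f \<otimes>\<^sub>m \<one> b) (g \<otimes>\<^sub>m \<one> b) (\<phi> x \<cdot> (h \<otimes>\<^sub>m \<one> b))"
    using tensor_exact_left[OF b] unfolding exact_endofunctor_def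
    by (elim conjE exE) (rule that)
  note bip = additive_endofunctor_biproduct[OF F]
  note D = tt_idealD[OF I]
  \<comment> \<open>With \<open>y\<close> on the left, \<open>y \<otimes> (x \<otimes> b)\<close> is
    in \<open>I\<close> because \<open>x \<otimes> b\<close> is; then regroup and swap
    \<open>x\<close> with \<open>y\<close>.\<close>
  have tens: "x \<otimes> y \<in> ?J" if "x \<in> ?J" "y \<in> obj K" for x y
  proof -
    have x: "x \<in> obj K" "x \<otimes> b \<in> I" using that(1) by auto
    have "y \<otimes> (x \<otimes> b) \<in> I" using D(10)[OF x(2) that(2)] .
    then have "(y \<otimes> x) \<otimes> b \<in> I"
      using D(4)[OF isomorphic_sym[OF tensor_assoc_isomorphic[OF that(2) x(1) b]]] by blast
    moreover have "isomorphic K ((y \<otimes> x) \<otimes> b) ((x \<otimes> y) \<otimes> b)"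
      using additive_endofunctor_isomorphic[OF F category_axioms]
        tensor_commute_isomorphic[OF that(2) x(1)] by blast
    ultimately have "(x \<otimes> y) \<otimes> b \<in> I" using D(4) by blast
    then show ?thesis using that(2) x(1) tensor_closed by blast
  qed
  show ?thesis
  proof (rule tt_idealI)
    show "z \<in> ?J" if "zero_object K z" for z
      using additive_endofunctor_zero_object[OF F that] D(2) that
      by (auto simp: zero_object_def)
    show "c \<in> ?J" if "x \<in> ?J" "y \<in> ?J" "is_biproduct K x y c" for x y c
      using D(3) bip[OF that(3)] that unfolding is_biproduct_def[of K x y c] by blast
    show iso: "y \<in> ?J" if "isomorphic K x y" "x \<in> ?J" for x y
      using D(4)[OF additive_endofunctor_isomorphic[OF F category_axioms that(1)]]
        isomorphic_obj that by blast
    show "\<Sigma> x \<in> ?J \<longleftrightarrow> x \<in> ?J" if x: "x \<in> obj K" for x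
    proof -
      have xb: "x \<otimes> b \<in> obj K" using tensor_closed x b by blast
      have i: "isomorphic K (\<Sigma> x \<otimes> b) (\<Sigma> (x \<otimes> b))"
        using shift x unfolding isomorphic_def by blast
      then have "\<Sigma> x \<otimes> b \<in> I \<longleftrightarrow> x \<otimes> b \<in> I"
        using D(4)[OF i] D(4)[OF isomorphic_sym[OF i]] D(5)[OF xb] by blast
      moreover have "\<Sigma> x \<in> obj K" using additive_endofunctorD(1)[OF shift_functor x] .
      ultimately show ?thesis using x by blast
    qed
    show "z \<in> ?J" if "dist_triangle K x y z f g h" "x \<in> ?J" "y \<in> ?J" for x y z f g h
    proof -
      have "g \<in> Hom K y z" using that(1) unfolding dist_triangle_def triangle_def by blast
      then have "z \<in> obj K" by (rule Hom_obj)
      then show ?thesis using D(6)[OF tri[rule_format, OF that(1)]] that by blast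
    qed
    show "x \<in> ?J" if "is_biproduct K x y c" "c \<in> ?J" for x y c
      using D(7)[OF bip[OF that(1)]] that unfolding is_biproduct_def[of K x y c] by blast
    show "y \<in> ?J" if "is_biproduct K x y c" "c \<in> ?J" for x y c
      using D(8)[OF bip[OF that(1)]] that unfolding is_biproduct_def[of K x y c] by blast
    show "x \<otimes> y \<in> ?J" if "x \<in> ?J" "y \<in> obj K" for x y
      using tens that .
    show "y \<otimes> x \<in> ?J" if "x \<in> ?J" "y \<in> obj K" for x y
      using iso[OF tensor_commute_isomorphic tens[OF that]] that by blast
  qed blast
qed

text \<open>Krull's argument with Zorn's lemma. If \<open>a \<otimes> b\<close> were in the maximal
  \<open>P\<close> with neither factor in \<open>P\<close>, two ideal quotients would replace first
  \<open>a\<close> and then \<open>b\<close> by a power of \<open>x\<close>.\<close>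

lemma prime_ideal_avoiding:
  assumes J: "tt_ideal K J" and x: "x \<in> obj K" and xJ: "x \<notin> tt_radical K J"
  obtains P where "prime_ideal K P" "J \<subseteq> P" "x \<notin> P"
proof -
  \<comment> \<open>Exponents start at one, as in \<open>tt_radical\<close>, so \<open>J\<close>
    belongs to the family because \<open>x\<close> is outside its radical.\<close>
  let ?S = "{I. tt_ideal K I \<and> J \<subseteq> I \<and> (\<forall>n. tensor_power K x (Suc n) \<notin> I)}"
  have "J \<in> ?S" using J x xJ unfolding tt_radical_def by auto
  have "\<exists>M\<in>?S. \<forall>I\<in>?S. M \<subseteq> I \<longrightarrow> I = M"
  proof (rule subset_Zorn_nonempty)
    show "?S \<noteq> {}" using \<open>J \<in> ?S\<close> by blast
    show "\<Union>\<C> \<in> ?S" if "\<C> \<noteq> {}" "subset.chain ?S \<C>" for \<C>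
    proof -
      have "\<C> \<subseteq> ?S" using that(2) unfolding subset_chain_def by blast
      then have "tt_ideal K (\<Union>\<C>)" using tt_ideal_Union_chain[OF that(1) _ that(2)] by blast
      then show ?thesis using \<open>\<C> \<subseteq> ?S\<close> that(1) by blast
    qed
  qed
  then obtain P where "P \<in> ?S" and P_max: "\<forall>I\<in>?S. P \<subseteq> I \<longrightarrow> I = P"
    by (elim bexE)
  then have P: "tt_ideal K P" "J \<subseteq> P" and pow: "\<And>n. tensor_power K x (Suc n) \<notin> P"
    by simp_all
  have max: "I = P" if "tt_ideal K I" "P \<subseteq> I" "\<And>n. tensor_power K x (Suc n) \<notin> I" for I
  proof -
    have "I \<in> ?S" using that P(2) by simp
    then show ?thesis using P_max that(2) by simp
  qed
  have "x \<notin> P" using pow[of 0] by simp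
  \<comment> \<open>The quotient of \<open>P\<close> by \<open>b\<close> contains \<open>P\<close>
    and also \<open>a\<close>, so it is strictly larger, and maximality forces a power of
    \<open>x\<close> into it.\<close>
  have power_tensor: "\<exists>n. tensor_power K x (Suc n) \<otimes> b \<in> P"
    if "a \<in> obj K" "b \<in> obj K" "a \<otimes> b \<in> P" "a \<notin> P" for a b
  proof -
    let ?I = "{c \<in> obj K. c \<otimes> b \<in> P}"
    have "tt_ideal K ?I" using tt_ideal_tensor_preimage P(1) that(2) .
    moreover have "P \<subseteq> ?I" using tt_idealD(1,9)[OF P(1)] that(2) by blast
    moreover have "?I \<noteq> P" using that by blast
    ultimately show ?thesis using max by blast
  qed
  have "a \<in> P \<or> b \<in> P" if ab: "a \<in> obj K" "b \<in> obj K" "a \<otimes> b \<in> P" for a b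
  proof (rule ccontr)
    assume "\<not> (a \<in> P \<or> b \<in> P)"
    then have "a \<notin> P" "b \<notin> P" by blast+
    obtain n where n: "tensor_power K x (Suc n) \<otimes> b \<in> P"
      using power_tensor[OF ab \<open>a \<notin> P\<close>] by blast
    note c = tensor_power_closed[OF x]
    \<comment> \<open>After the swap \<open>b\<close> takes the part of the first factor, and the
      power of \<open>x\<close> already found that of the second.\<close>
    have "b \<otimes> tensor_power K x (Suc n) \<in> P"
      using tt_idealD(4)[OF P(1) tensor_commute_isomorphic[OF c ab(2)] n] .
    then obtain m where "tensor_power K x (Suc m) \<otimes> tensor_power K x (Suc n) \<in> P"
      using power_tensor[OF ab(2) c _ \<open>b \<notin> P\<close>] by blast
    then have "tensor_power K x (Suc m + Suc n) \<in> P"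
      using tt_idealD(4)[OF P(1) tensor_power_Suc_add_isomorphic[OF x]] by blast
    then show False using pow[of "m + Suc n"] by (simp only: add_Suc)
  qed
  then have "prime_ideal K P" unfolding prime_ideal_def using P(1) x \<open>x \<notin> P\<close> by blast
  then show thesis using that P(2) \<open>x \<notin> P\<close> by blast
qed

section \<open>Finiteness of the spectrum\<close>

lemma prime_ideal_radical:
  assumes P: "prime_ideal K P"
  shows "radical_ideal K P"
proof (rule radical_idealI)
  show "tt_ideal K P" using prime_idealD(1)[OF P] .
  have "x \<in> P" if x: "x \<in> obj K" and "tensor_power K x (Suc n) \<in> P" for x n
    using that(2)
  proof (induction n)
    case (Suc n)
    then show ?case
      using prime_idealD(2)[OF P x tensor_power_closed[OF x, of "Suc n"]] by auto
  qed simp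
  then show "tt_radical K P \<subseteq> P"
    unfolding tt_radical_def by (auto simp: Suc_le_eq gr0_conv_Suc)
qed

lemma finitely_generated_if_finite_Spc:
  assumes fin: "finite (Spc K)" and I: "radical_ideal K I"
  shows "finitely_generated_radical K I"
proof -
  have I': "tt_ideal K I" "tt_radical K I = I" using I unfolding radical_ideal_def by auto
  \<comment> \<open>Each prime not containing \<open>I\<close> receives a witness \<open>c P\<close>
    in \<open>I\<close>; these finitely many witnesses generate \<open>I\<close> up to
    radical.\<close>
  define N where "N = {P \<in> Spc K. \<not> I \<subseteq> P}"
  have "\<forall>P \<in> N. \<exists>x. x \<in> I - P" unfolding N_def by blast
  then obtain c where c: "\<And>P. P \<in> N \<Longrightarrow> c P \<in> I - P" by metis
  let ?X = "c ` N"
  have X: "?X \<subseteq> I" using c by blast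
  have gen: "tt_ideal K (ideal_generated K ?X)"
    unfolding ideal_generated_def using I'(1) X by (intro tt_ideal_Inter) auto
  have "tt_radical K (ideal_generated K ?X) \<subseteq> I"
    using tt_radical_mono[OF ideal_generated_subset[OF I'(1) X], of K] I'(2) by simp
  moreover have "I \<subseteq> tt_radical K (ideal_generated K ?X)"
  proof (rule ccontr)
    assume "\<not> I \<subseteq> tt_radical K (ideal_generated K ?X)"
    then obtain x where x: "x \<in> I" "x \<notin> tt_radical K (ideal_generated K ?X)" by blast
    then have "x \<in> obj K" using tt_idealD(1)[OF I'(1)] by blast
    \<comment> \<open>Such a \<open>P\<close> misses \<open>x \<in> I\<close> and so belongs to
      \<open>N\<close>, yet it contains its own witness \<open>c P\<close>.\<close>
    then obtain P where P: "prime_ideal K P" "ideal_generated K ?X \<subseteq> P" "x \<notin> P"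
      using prime_ideal_avoiding[OF gen _ x(2)] by blast
    then have "P \<in> N" unfolding N_def Spc_def using x(1) by blast
    then show False using c P(2) subset_ideal_generated[of ?X K] by blast
  qed
  moreover have "finite ?X" unfolding N_def using fin by simp
  moreover have "?X \<subseteq> obj K" using X tt_idealD(1)[OF I'(1)] by blast
  ultimately show ?thesis unfolding finitely_generated_radical_def by blast
qed

section \<open>Compact open sets and weak visibility in the spectrum\<close>

lemma compactin_Spc_basis:
  assumes "openin (Spc_topology K) U" "compactin (Spc_topology K) U"
  obtains X where "finite X" "X \<subseteq> obj K" "Spc K - U = {P \<in> Spc K. X \<inter> P = {}}"
proof -
  have "\<exists>\<B>. \<B> \<subseteq> Collect (\<lambda>U. \<exists>x \<in> obj K. U = Spc K - supp K x) \<and> \<Union>\<B> = U"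
    using assms(1) unfolding openin_Spc_topology union_of_def arbitrary_def by simp
  then obtain \<B> where "\<B> \<subseteq> Collect (\<lambda>U. \<exists>x \<in> obj K. U = Spc K - supp K x)" and U: "\<Union>\<B> = U"
    by blast
  then have \<B>: "\<exists>x \<in> obj K. B = Spc K - supp K x" if "B \<in> \<B>" for B
    using that by blast
  have "openin (Spc_topology K) B" if "B \<in> \<B>" for B
    unfolding openin_Spc_topology using \<B>[OF that] by (intro arbitrary_union_of_inc)
  then obtain \<F> where \<F>: "finite \<F>" "\<F> \<subseteq> \<B>" "U \<subseteq> \<Union>\<F>"
    using assms(2) U unfolding compactin_def by (metis order_refl)
  obtain x where x: "\<And>B. B \<in> \<B> \<Longrightarrow> x B \<in> obj K \<and> B = Spc K - supp K (x B)"
    using \<B> by metis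
  have "\<Union>\<F> = U" using \<F> U by blast
  moreover have "Spc K - \<Union>\<F> = {P \<in> Spc K. x ` \<F> \<inter> P = {}}"
  proof -
    \<comment> \<open>Basic open sets consist of the primes that contain a given object, so the
      primes outside a finite union of them are those avoiding all the chosen objects.\<close>
    have "P \<in> B \<longleftrightarrow> x B \<in> P" if "P \<in> Spc K" "B \<in> \<F>" for P B
      using x[of B] \<F>(2) that unfolding supp_def by blast
    then show ?thesis by blast
  qed
  ultimately show thesis using that[of "x ` \<F>"] \<F> x by blast
qed

text \<open>Thomason sets are closed under passing to smaller primes. A prime above \<open>R\<close>
  avoiding \<open>X\<close> lies in the first Thomason set; being different from \<open>R\<close> it
  lies in the second, which would then contain \<open>R\<close> too.\<close>

lemma weakly_visible_Spc_separation:
  assumes wv: "weakly_visible (Spc_topology K) {R}"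
  obtains X where "finite X" "X \<inter> R = {}"
    "\<And>P. \<lbrakk>P \<in> Spc K; R \<subset> P\<rbrakk> \<Longrightarrow> X \<inter> P \<noteq> {}"
proof -
  obtain \<U> \<V> where \<U>: "\<And>U. U \<in> \<U> \<Longrightarrow> openin (Spc_topology K) U \<and> compactin (Spc_topology K) U"
    and \<V>: "\<And>U. U \<in> \<V> \<Longrightarrow> openin (Spc_topology K) U \<and> compactin (Spc_topology K) U"
    and R: "{R} = (\<Union>U \<in> \<U>. Spc K - U) \<inter> (Spc K - (\<Union>U \<in> \<V>. Spc K - U))"
    using wv unfolding weakly_visible_def Thomason_def topspace_Spc_topology by metis
  have "R \<in> (\<Union>U \<in> \<U>. Spc K - U)" using R by blast
  \<comment> \<open>One piece of the first Thomason set through \<open>R\<close> supplies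
    \<open>X\<close>, which therefore avoids \<open>R\<close>.\<close>
  then obtain U where U: "U \<in> \<U>" "R \<in> Spc K - U" by blast
  obtain X where X: "finite X" "Spc K - U = {P \<in> Spc K. X \<inter> P = {}}"
    using compactin_Spc_basis \<U>[OF U(1)] by metis
  have "X \<inter> P \<noteq> {}" if P: "P \<in> Spc K" "R \<subset> P" for P
  proof
    assume "X \<inter> P = {}"
    then have "P \<in> Spc K - U" using X P(1) by blast
    moreover have "P \<notin> {R}" using P(2) by blast
    ultimately obtain V where V: "V \<in> \<V>" "P \<in> Spc K - V" using R U(1) P(1) by blast
    obtain Y where Y: "Spc K - V = {P \<in> Spc K. Y \<inter> P = {}}"
      using compactin_Spc_basis \<V>[OF V(1)] by metis
    \<comment> \<open>\<open>Y\<close> is disjoint from \<open>P\<close>, hence from the smaller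
      \<open>R\<close>.\<close>
    then have "R \<in> Spc K - V" using V(2) P(2) U(2) by blast
    then show False using R V(1) by blast
  qed
  then show thesis using that X U(2) by blast
qed

section \<open>From finite generation to a finite spectrum\<close>

lemma finite_Spc_if_finitely_generated:
  assumes fg: "\<And>I. radical_ideal K I \<Longrightarrow> finitely_generated_radical K I"
    and wN: "weakly_Noetherian (Spc_topology K)"
  shows "finite (Spc K)"
proof (rule ccontr)
  assume inf: "infinite (Spc K)"
  define V where "V I = {P \<in> Spc K. I \<subseteq> P}" for I
  let ?S = "{I. radical_ideal K I \<and> infinite (V I)}"
  have rad: "radical_ideal K P" if "P \<in> Spc K" for P
    using that prime_ideal_radical unfolding Spc_def by blast
  \<comment> \<open>Every prime in \<open>\<A>\<close> lies above \<open>\<Inter>\<A>\<close>. With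
    \<open>\<A>\<close> the whole spectrum this shows that \<open>?S\<close> is nonempty; later it
    is played against maximality.\<close>
  have Inter_S: "\<Inter>\<A> \<in> ?S" if "infinite \<A>" "\<A> \<subseteq> Spc K" for \<A>
  proof -
    have "\<A> \<subseteq> V (\<Inter>\<A>)" unfolding V_def using that(2) by blast
    then have "infinite (V (\<Inter>\<A>))" using that(1) finite_subset by blast
    moreover have "radical_ideal K (\<Inter>\<A>)"
      using that rad by (intro radical_ideal_Inter) auto
    ultimately show ?thesis by blast
  qed
  have "\<exists>R\<in>?S. \<forall>I\<in>?S. R \<subseteq> I \<longrightarrow> I = R"
  proof (rule subset_Zorn_nonempty)
    show "?S \<noteq> {}" using Inter_S[OF inf order_refl] by blast
    show "\<Union>\<C> \<in> ?S" if "\<C> \<noteq> {}" "subset.chain ?S \<C>" for \<C>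
    proof -
      have sub: "\<C> \<subseteq> ?S" using that(2) unfolding subset_chain_def by blast
      then have r: "radical_ideal K (\<Union>\<C>)"
        using radical_ideal_Union_chain[OF that(1) _ that(2)] by blast
      then obtain X where X: "finite X" "X \<subseteq> obj K" "\<Union>\<C> = tt_radical K (ideal_generated K X)"
        using fg[OF r] unfolding finitely_generated_radical_def by (elim exE conjE)
      have "ideal_generated K X \<subseteq> obj K"
        using ideal_generated_subset[OF tt_ideal_obj X(2)] .
      then have "X \<subseteq> \<Union>\<C>"
        using X(3) subset_ideal_generated[of X K] subset_tt_radical by blast
      \<comment> \<open>A finite generating set of the union already lies in one member
        \<open>I\<close> of the chain, and \<open>I\<close>, being radical, absorbs the whole union.
        The union is thus itself a member and keeps \<open>V\<close> infinite.\<close>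
      then obtain I where I: "I \<in> \<C>" "X \<subseteq> I"
        using finite_subset_Union_chain[OF X(1) _ \<open>\<C> \<noteq> {}\<close> \<open>subset.chain ?S \<C>\<close>] by blast
      then have I': "tt_ideal K I" "tt_radical K I = I"
        using sub unfolding radical_ideal_def by auto
      have "\<Union>\<C> \<subseteq> I"
        using tt_radical_mono[OF ideal_generated_subset[OF I'(1) I(2)], of K] X(3) I'(2) by simp
      then have "\<Union>\<C> = I" using I(1) by blast
      then show ?thesis using I(1) sub by blast
    qed
  qed
  then obtain R where "R \<in> ?S" and R_max: "\<forall>I\<in>?S. R \<subseteq> I \<longrightarrow> I = R"
    by (elim bexE)
  then have R: "radical_ideal K R" "infinite (V R)" by simp_all
  have max: "I = R" if "I \<in> ?S" "R \<subseteq> I" for I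
    by (rule R_max[rule_format, OF that])
  have V_Spc: "{P \<in> V R. a \<in> P} \<subseteq> Spc K" for a unfolding V_def by blast
  \<comment> \<open>Otherwise the intersection of these primes is a member of \<open>?S\<close>
    above \<open>R\<close>, hence equal to \<open>R\<close>, although it contains
    \<open>a\<close>.\<close>
  have fin: "finite {P \<in> V R. a \<in> P}" if "a \<notin> R" for a
  proof (rule ccontr)
    assume "infinite {P \<in> V R. a \<in> P}"
    then have "\<Inter>{P \<in> V R. a \<in> P} \<in> ?S" by (intro Inter_S V_Spc)
    moreover have "R \<subseteq> \<Inter>{P \<in> V R. a \<in> P}" unfolding V_def by blast
    ultimately have "\<Inter>{P \<in> V R. a \<in> P} = R" by (rule max)
    then show False using that by blast
  qed
  \<comment> \<open>A prime above \<open>R\<close> contains \<open>a \<otimes> b\<close>, hence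
    \<open>a\<close> or \<open>b\<close>; two finite sets cannot cover the infinite
    \<open>V R\<close>.\<close>
  have "a \<in> R \<or> b \<in> R" if ab: "a \<in> obj K" "b \<in> obj K" "a \<otimes> b \<in> R" for a b
  proof (rule ccontr)
    assume "\<not> (a \<in> R \<or> b \<in> R)"
    then have "finite ({P \<in> V R. a \<in> P} \<union> {P \<in> V R. b \<in> P})" using fin by simp
    moreover have "V R \<subseteq> {P \<in> V R. a \<in> P} \<union> {P \<in> V R. b \<in> P}"
    proof
      fix P assume P: "P \<in> V R"
      then have "prime_ideal K P" "a \<otimes> b \<in> P" using ab(3) unfolding V_def Spc_def by auto
      then have "a \<in> P \<or> b \<in> P" using prime_idealD(2) ab(1,2) by metis
      then show "P \<in> {P \<in> V R. a \<in> P} \<union> {P \<in> V R. b \<in> P}" using P by blast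
    qed
    ultimately show False using R(2) finite_subset by blast
  qed
  \<comment> \<open>Primes are proper, so no prime lies above \<open>obj K\<close>, whereas
    \<open>V R\<close> is infinite.\<close>
  moreover have "R \<noteq> obj K"
  proof
    assume "R = obj K"
    then have "V R = {}"
      unfolding V_def Spc_def using tt_idealD(1)[OF prime_idealD(1)]
      by (auto simp: prime_ideal_def)
    then show False using R(2) by simp
  qed
  ultimately have "R \<in> Spc K"
    using R(1) unfolding Spc_def prime_ideal_def radical_ideal_def by blast
  then have "weakly_visible (Spc_topology K) {R}"
    using wN unfolding weakly_Noetherian_def topspace_Spc_topology by blast
  then obtain X where X: "finite X" "X \<inter> R = {}"
    and sep: "\<And>P. \<lbrakk>P \<in> Spc K; R \<subset> P\<rbrakk> \<Longrightarrow> X \<inter> P \<noteq> {}"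
    using weakly_visible_Spc_separation by metis
  \<comment> \<open>A prime above \<open>R\<close> is \<open>R\<close> itself or properly larger,
    and then it meets \<open>X\<close>. As \<open>X\<close> avoids \<open>R\<close>, each
    \<open>a \<in> X\<close> accounts for finitely many primes only.\<close>
  have "V R \<subseteq> insert R (\<Union>a \<in> X. {P \<in> V R. a \<in> P})" using sep unfolding V_def by blast
  moreover have "finite (insert R (\<Union>a \<in> X. {P \<in> V R. a \<in> P}))" using X fin by blast
  ultimately show False using R(2) finite_subset by blast
qed

end

theorem theorem1:
  fixes K :: "('o, 'm, 'x) tensor_triangulated_scheme"
  assumes "tt_category K"
    and "weakly_Noetherian (Spc_topology K)"
  shows "(\<forall>I. radical_ideal K I \<longrightarrow> finitely_generated_radical K I) \<longleftrightarrow> finite (Spc K)"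
  using tt_category.finite_Spc_if_finitely_generated[OF assms(1) _ assms(2)]
    tt_category.finitely_generated_if_finite_Spc[OF assms(1)] by blast

end
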